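(* Let $\mathcal{C}$ be a shellable polytopal complex with shelling $(F_1,\ldots,F_s)$, and let $\varphi:\mathcal{C}'\rightarrow\mathcal{C}$ be a (topological) subdivision of $\mathcal{C}$. For $i\in[s]$ let $$\mathcal{R}_i := \mathcal{C}'|_{F_i}\setminus\Big(\bigcup_{k=1}^{i-1}\mathcal{C}'|_{F_k}\Big)$$ be the relative complex associated to $F_i$ by $(F_1,\ldots,F_s)$ and $\varphi$. If there is a permutation $\sigma\in\mathfrak{S}_s$ such that $(h(\mathcal{R}_{\sigma(i)};x))_{i=1}^s$ is an interlacing sequence, then $h(\mathcal{C}';x)$ is real-rooted.
   Context: A polytopal complex is a collection of (abstract) polytopes that contains the empty polytope $\emptyset$ (of dimension $-1$), is closed under taking faces, and in which any two members intersect in a common face of both. Its maximal members are its facets; it is pure if all facets have the same dimension. For a polytope $P$, $\mathcal{C}(P)$ is the complex of all faces of $P$, $\mathcal{C}(\partial P)$ is the complex of all proper faces, and $\mathcal{C}(P_1\cup\cdots\cup P_m)=\bigcup_i\mathcal{C}(P_i)$. If $\mathcal{D}$ is a subcomplex of $\mathcal{C}$ (possibly $\mathcal{D}=\emptyset$, having no faces at all), $\mathcal{C}\setminus\mathcal{D}=\{P\in\mathcal{C}:P\notin\mathcal{D}\}$ is a relative complex, of dimension the largest dimension of a member. $f$- and $h$-polynomials: $f(\mathcal{C};x)=\sum_{k\ge -1}f_k(\mathcal{C})x^{k+1}$, where $f_k$ counts $k$-dimensional faces ($f_{-1}=1$ if $\mathcal{C}\ne\emptyset$); $f(\mathcal{C}\setminus\mathcal{D};x)=f(\mathcal{C};x)-f(\mathcal{D};x)$;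 and for an $(m-1)$-dimensional relative complex, $h(\mathcal{C}\setminus\mathcal{D};x)=(1-x)^m f\big(\mathcal{C}\setminus\mathcal{D};\frac{x}{1-x}\big)$. A (topological) subdivision of $\mathcal{C}$ is a polytopal complex $\mathcal{C}'$ such that each face $F\in\mathcal{C}$ is subdivided into a ball by faces of $\mathcal{C}'$, the boundary of this ball being a subdivision of the boundary of $F$; $\varphi:\mathcal{C}'\to\mathcal{C}$ denotes the associated inclusion map, and $\mathcal{C}'|_F$ is the subcomplex of $\mathcal{C}'$ subdividing $F$ and its faces. A shelling of a pure $d$-dimensional polytopal complex $\mathcal{C}$ is a linear ordering $(F_1,\ldots,F_s)$ of its facets such that either $d=0$, or (1) $\mathcal{C}(\partial F_1)$ has a shelling, and (2) for $2\le j\le s$, $F_j\cap\bigcup_{i<j}F_i$ is nonempty and equals $G_1\cup\cdots\cup G_r$ for some shelling $(G_1,\ldots,G_r,\ldots,G_t)$ of $\mathcal{C}(\partial F_j)$ and some $r\in[t]$. A complex is shellable if it is pure and admits a shelling. A polynomial in $\mathbb{R}[x]$ is real-rooted if it is identically zero or has only real zeros. For real-rooted $p,q$: they interlace if there is a zero of $p$ between each pair of zeros of $q$ (counted with multiplicity) and vice versa; $p\prec q$ means that $p,q$ are real-rooted, interlace, and $p'q-pq'\le 0$ on all of $\mathbb{R}$; moreover $0\prec p$ and $p\prec 0$ for every real-rooted $p$. A sequence $(p_1,\ldots,p_s)$ of real-rooted polynomials is an interlacing sequence if $p_i\prec p_j$ for all $1\le i\le j\le s$. *)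

theory Defs
  imports "HOL-Analysis.Analysis" "HOL-Computational_Algebra.Computational_Algebra"
    "HOL-Combinatorics.Permutations"
begin

section \<open>Abstract polytopes and polytopal complexes\<close>

text \<open>
  A face is identified with its set of vertices, so a complex is a finite family of sets, ordered by
  inclusion. This loses nothing: any two faces of a polytopal complex meet in a common face, hence
  the faces of each of its polytopes form a lattice; by the diamond property this lattice is
  generated by its atoms, and the intersection of faces is the intersection of their vertex sets.
  The faces of a member \<open>F\<close> of \<open>C\<close> are the members of \<open>C\<close> contained in \<open>F\<close>.
\<close>

definition faces :: "'v set set \<Rightarrow> 'v set \<Rightarrow> 'v set set" where
  "faces C F = {G \<in> C. G \<subseteq> F}"

definition proper_faces :: "'v set set \<Rightarrow> 'v set \<Rightarrow> 'v set set" where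
  "proper_faces C F = {G \<in> C. G \<subset> F}"

text \<open>
  The rank function, shifted so that the empty polytope has dimension \<open>-1\<close>: a face of dimension
  \<open>k\<close> sits on top of chains with \<open>k + 1\<close> proper faces, the empty one included.
\<close>

definition face_dim :: "'v set set \<Rightarrow> 'v set \<Rightarrow> int" where
  "face_dim C F = int (Max (card ` {K. subset.chain (proper_faces C F) K})) - 1"

text \<open>
  The four axioms of McMullen and Schulte: least and greatest faces, flags of equal length, strong
  connectedness, and the diamond property. The section between \<open>F\<close> and \<open>G\<close> has rank
  \<open>face_dim P G - face_dim P F - 1\<close>; connectedness is required of sections of rank at least 2.
\<close>

definition between :: "'v set set \<Rightarrow> 'v set \<Rightarrow> 'v set \<Rightarrow> 'v set set" where
  "between P F G = {H \<in> P. F \<subset> H \<and> H \<subset> G}"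

definition abstract_polytope :: "'v set set \<Rightarrow> bool" where
  "abstract_polytope P \<longleftrightarrow>
     finite P \<and>
     (\<exists>B\<in>P. \<exists>T\<in>P. \<forall>G\<in>P. B \<subseteq> G \<and> G \<subseteq> T) \<and>
     (\<exists>n. \<forall>K. subset.maxchain P K \<longrightarrow> card K = n) \<and>
     (\<forall>F\<in>P. \<forall>G\<in>P. F \<subseteq> G \<and> face_dim P G \<ge> face_dim P F + 3 \<longrightarrow>
        (\<forall>H\<in>between P F G. \<forall>H'\<in>between P F G.
           (H, H') \<in> {(X, Y). X \<in> between P F G \<and> Y \<in> between P F G \<and>
                               (X \<subseteq> Y \<or> Y \<subseteq> X)}\<^sup>*)) \<and>
     (\<forall>F\<in>P. \<forall>G\<in>P. F \<subseteq> G \<and> face_dim P G = face_dim P F + 2 \<longrightarrow>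
        card (between P F G) = 2)"

definition polytopal_complex :: "'v set set \<Rightarrow> bool" where
  "polytopal_complex C \<longleftrightarrow>
     finite C \<and> {} \<in> C \<and>
     (\<forall>F\<in>C. abstract_polytope (faces C F) \<and> (\<forall>v\<in>F. {v} \<in> C)) \<and>
     (\<forall>F\<in>C. \<forall>G\<in>C. F \<inter> G \<in> C)"

definition facets :: "'v set set \<Rightarrow> 'v set set" where
  "facets C = {F \<in> C. \<forall>G\<in>C. F \<subseteq> G \<longrightarrow> G = F}"

definition pure :: "'v set set \<Rightarrow> bool" where
  "pure C \<longleftrightarrow> (\<forall>F\<in>facets C. \<forall>G\<in>facets C. face_dim C F = face_dim C G)"


section \<open>Relative complexes and their \<open>f\<close>- and \<open>h\<close>-polynomials\<close>

text \<open>
  A relative complex of \<open>C\<close> is given by its set of faces \<open>R \<subseteq> C\<close>, and \<open>C\<close> itself is the case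
  \<open>R = C\<close>. The dimensions of faces are taken in \<open>C\<close>.
\<close>

definition rel_dim :: "'v set set \<Rightarrow> 'v set set \<Rightarrow> int" where
  "rel_dim C R = Max (face_dim C ` R)"

abbreviation complex_dim :: "'v set set \<Rightarrow> int" where
  "complex_dim C \<equiv> rel_dim C C"

definition f_poly :: "'v set set \<Rightarrow> 'v set set \<Rightarrow> real poly" where
  "f_poly C R = (\<Sum>F\<in>R. monom 1 (nat (face_dim C F + 1)))"

text \<open>
  With \<open>m - 1\<close> the dimension of \<open>R\<close>, this is \<open>(1 - x)\<^sup>m f(x / (1 - x))\<close> with denominators cleared;
  see \<open>poly_h_poly\<close> below.
\<close>

definition h_poly :: "'v set set \<Rightarrow> 'v set set \<Rightarrow> real poly" where
  "h_poly C R =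
     (let m = nat (rel_dim C R + 1)
      in \<Sum>k\<le>m. smult (coeff (f_poly C R) k) (monom 1 k * [:1, -1:] ^ (m - k)))"

lemma face_dim_ge: "face_dim C F \<ge> -1"
  by (simp add: face_dim_def)

lemma coeff_f_poly:
  assumes "finite R"
  shows "coeff (f_poly C R) k = card {F \<in> R. face_dim C F = int k - 1}"
proof -
  have eq: "nat (face_dim C F + 1) = k \<longleftrightarrow> face_dim C F = int k - 1" for F
    using face_dim_ge[of C F] by auto
  show ?thesis
    using assms by (simp add: f_poly_def coeff_sum eq flip: sum.inter_filter)
qed

lemma f_poly_diff:
  assumes "finite C" "A \<subseteq> C" "D \<subseteq> A"
  shows "f_poly C (A - D) = f_poly C A - f_poly C D"
  using assms by (simp add: f_poly_def sum_diff finite_subset)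

lemma poly_h_poly:
  assumes "finite R" "x \<noteq> 1" "m = nat (rel_dim C R + 1)"
  shows "poly (h_poly C R) x = (1 - x) ^ m * poly (f_poly C R) (x / (1 - x))"
proof -
  have "degree (f_poly C R) \<le> m"
    unfolding f_poly_def
  proof (rule degree_sum_le)
    fix F assume "F \<in> R"
    then have "face_dim C F \<le> rel_dim C R"
      using assms by (simp add: rel_dim_def)
    then show "degree (monom (1::real) (nat (face_dim C F + 1))) \<le> m"
      using assms by (simp add: degree_monom_eq)
  qed (use assms in simp)
  then have f: "poly (f_poly C R) y = (\<Sum>k\<le>m. coeff (f_poly C R) k * y ^ k)" for y
    unfolding poly_altdef by (intro sum.mono_neutral_left) (auto simp: coeff_eq_0)
  have "x ^ k * (1 - x) ^ (m - k) = (1 - x) ^ m * (x / (1 - x)) ^ k" if "k \<le> m" for k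
    using that assms by (simp add: power_diff power_divide)
  then show ?thesis
    unfolding h_poly_def f Let_def assms(3)[symmetric]
    by (simp add: poly_sum poly_monom sum_distrib_left mult.assoc mult.left_commute)
qed


section \<open>Shellings\<close>

text \<open>
  Intersections and unions of polytopes are expressed through the complexes of their faces; in
  particular an intersection is nonempty iff its complex is not just \<open>{{}}\<close>. Indices start at 0.
\<close>

inductive shelling :: "'v set set \<Rightarrow> 'v set list \<Rightarrow> bool" where
  "\<lbrakk> polytopal_complex C; pure C; distinct Fs; set Fs = facets C;
     complex_dim C = 0 \<or>
     (\<exists>Gs. shelling (proper_faces C (Fs ! 0)) Gs) \<and>
     (\<forall>j. 1 \<le> j \<and> j < length Fs \<longrightarrow>
        faces C (Fs ! j) \<inter> (\<Union>i<j. faces C (Fs ! i)) \<noteq> {{}} \<and>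
        (\<exists>Gs r. shelling (proper_faces C (Fs ! j)) Gs \<and> 1 \<le> r \<and> r \<le> length Gs \<and>
           faces C (Fs ! j) \<inter> (\<Union>i<j. faces C (Fs ! i)) = (\<Union>i<r. faces C (Gs ! i))))
   \<rbrakk> \<Longrightarrow> shelling C Fs"


section \<open>Topological subdivisions\<close>

text \<open>
  The geometric realization of an abstract complex, via its barycentric subdivision: the points are
  the convex combinations of chains of nonempty faces, in barycentric coordinates.
\<close>

definition realization :: "'v set set \<Rightarrow> ('v set \<Rightarrow> real) set" where
  "realization C =
     {w. (\<forall>F. 0 \<le> w F) \<and> subset.chain (C - {{}}) {F. w F \<noteq> 0} \<and> (\<Sum>F\<in>C. w F) = 1}"

definition unit_ball :: "nat \<Rightarrow> (nat \<Rightarrow> real) set" where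
  "unit_ball n = {x \<in> topspace (Euclidean_space n). (\<Sum>i<n. (x i)\<^sup>2) \<le> 1}"

definition unit_sphere :: "nat \<Rightarrow> (nat \<Rightarrow> real) set" where
  "unit_sphere n = {x \<in> topspace (Euclidean_space n). (\<Sum>i<n. (x i)\<^sup>2) = 1}"

text \<open>
  \<open>A\<close> is an \<open>n\<close>-dimensional ball whose boundary is the subcomplex \<open>B\<close>. The case \<open>n = -1\<close> concerns
  the complex of the empty polytope, which has an empty realization.
\<close>

definition ball_with_boundary :: "int \<Rightarrow> 'v set set \<Rightarrow> 'v set set \<Rightarrow> bool" where
  "ball_with_boundary n A B \<longleftrightarrow>
     complex_dim A = n \<and>
     (if n = -1 then A = {{}} \<and> B = {}
      else \<exists>h. homeomorphic_map (subtopology (powertop_real UNIV) (realization A))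
                 (subtopology (Euclidean_space (nat n)) (unit_ball (nat n))) h \<and>
               h ` realization B = unit_sphere (nat n))"

text \<open>
  The inclusion map \<open>\<phi>\<close> sends a face of the subdivision to the smallest face of \<open>C\<close> containing it,
  so \<open>restriction C' \<phi> F\<close> consists of the faces of \<open>C'\<close> that lie in \<open>F\<close>, and those lying in a proper
  face of \<open>F\<close> subdivide the boundary of \<open>F\<close>.
\<close>

definition restriction :: "'w set set \<Rightarrow> ('w set \<Rightarrow> 'v set) \<Rightarrow> 'v set \<Rightarrow> 'w set set" where
  "restriction C' \<phi> F = {G \<in> C'. \<phi> G \<subseteq> F}"

definition subdivision :: "'w set set \<Rightarrow> 'v set set \<Rightarrow> ('w set \<Rightarrow> 'v set) \<Rightarrow> bool" where
  "subdivision C' C \<phi> \<longleftrightarrow>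
     polytopal_complex C' \<and> polytopal_complex C \<and>
     \<phi> ` C' \<subseteq> C \<and>
     (\<forall>G\<in>C'. \<forall>H\<in>C'. G \<subseteq> H \<longrightarrow> \<phi> G \<subseteq> \<phi> H) \<and>
     (\<forall>F\<in>C. ball_with_boundary (face_dim C F) (restriction C' \<phi> F)
               (\<Union>E\<in>proper_faces C F. restriction C' \<phi> E))"

definition relative_complex ::
    "'w set set \<Rightarrow> ('w set \<Rightarrow> 'v set) \<Rightarrow> 'v set list \<Rightarrow> nat \<Rightarrow> 'w set set" where
  "relative_complex C' \<phi> Fs i =
     restriction C' \<phi> (Fs ! i) - (\<Union>k<i. restriction C' \<phi> (Fs ! k))"


section \<open>Real-rooted and interlacing polynomials\<close>

definition real_rooted :: "real poly \<Rightarrow> bool" where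
  "real_rooted p \<longleftrightarrow> p = 0 \<or> (\<forall>z::complex. poly (map_poly of_real p) z = 0 \<longrightarrow> z \<in> \<real>)"

definition real_zeros :: "real poly \<Rightarrow> real list" where
  "real_zeros p = sorted_list_of_multiset (proots p)"

text \<open>
  Multiplicities are counted on both sides: the gaps between consecutive zeros of \<open>q\<close> (possibly
  of length 0) are matched with different entries of the list of zeros of \<open>p\<close>.
\<close>

definition zero_between :: "real poly \<Rightarrow> real poly \<Rightarrow> bool" where
  "zero_between p q \<longleftrightarrow>
     (let a = real_zeros p; b = real_zeros q; I = {i. Suc i < length b}
      in \<exists>j. inj_on j I \<and>
             (\<forall>i\<in>I. j i < length a \<and> b ! i \<le> a ! j i \<and> a ! j i \<le> b ! Suc i))"

definition interlace :: "real poly \<Rightarrow> real poly \<Rightarrow> bool" where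
  "interlace p q \<longleftrightarrow> zero_between p q \<and> zero_between q p"

definition interlaces :: "real poly \<Rightarrow> real poly \<Rightarrow> bool"  (infix \<open>\<prec>\<prec>\<close> 50) where
  "p \<prec>\<prec> q \<longleftrightarrow> real_rooted p \<and> real_rooted q \<and>
     (p = 0 \<or> q = 0 \<or>
      interlace p q \<and> (\<forall>x. poly (pderiv p * q - p * pderiv q) x \<le> 0))"

definition interlacing_sequence :: "real poly list \<Rightarrow> bool" where
  "interlacing_sequence ps \<longleftrightarrow>
     (\<forall>p\<in>set ps. real_rooted p) \<and>
     (\<forall>i j. i \<le> j \<and> j < length ps \<longrightarrow> ps ! i \<prec>\<prec> ps ! j)"

end

theory Submission
  imports Defs
begin

text \<open>
  The relative complexes partition \<open>C'\<close>, and they all have the dimension of \<open>C'\<close>: the ball over a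
  facet has a face of full dimension, and such a face cannot lie over the intersection with another
  facet. Hence \<open>h(C')\<close> is the sum of their \<open>h\<close>-polynomials.

  For \<open>p \<prec> q\<close> the quotient \<open>q / p\<close> either is constant or maps the open upper half-plane into itself:
  the zeros alternate, so at each point of the half-plane the arguments of the linear factors form an
  alternating sum within \<open>(0, \<pi>)\<close> or \<open>(- \<pi>, 0)\<close>, and the sign of the Wronskian excludes the lower
  half-plane. If \<open>p\<close> is the first nonzero member of an interlacing sequence with sum \<open>s\<close>, then
  \<open>s / p\<close> is constant or has positive imaginary part on the upper half-plane, so that all zeros of
  \<open>s\<close> are real.
\<close>

section \<open>Zeros of real-rooted polynomials\<close>

abbreviation cpoly :: "real poly \<Rightarrow> complex \<Rightarrow> complex" where
  "cpoly p \<equiv> poly (map_poly of_real p)"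

lemma cpoly_pCons: "cpoly (pCons a p) z = of_real a + z * cpoly p z"
  by (simp add: map_poly_pCons)

lemma cpoly_add: "cpoly (p + q) z = cpoly p z + cpoly q z"
  by (induction p q rule: poly_induct2) (auto simp: algebra_simps cpoly_pCons)

lemma cpoly_smult: "cpoly (smult c p) z = of_real c * cpoly p z"
  by (induction p) (auto simp: algebra_simps cpoly_pCons)

lemma cpoly_mult: "cpoly (p * q) z = cpoly p z * cpoly q z"
  by (induction p) (auto simp: algebra_simps cpoly_add cpoly_smult cpoly_pCons)

lemma cpoly_sum: "cpoly (sum f A) z = (\<Sum>i\<in>A. cpoly (f i) z)"
  by (induction A rule: infinite_finite_induct) (auto simp: cpoly_add)

lemma cpoly_of_real: "cpoly p (of_real x) = of_real (poly p x)"
  by (induction p) (auto simp: cpoly_pCons)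

lemma cpoly_cnj: "cpoly p (cnj z) = cnj (cpoly p z)"
  by (induction p) (auto simp: cpoly_pCons)

text \<open>Induction on the degree: the fundamental theorem of algebra supplies a complex zero,
  which real-rootedness makes real, and its linear factor is split off.\<close>

lemma real_rooted_decompose:
  assumes "real_rooted p"
  shows "p = smult (lead_coeff p) (\<Prod>x\<in>#proots p. [:-x, 1:])"
  using assms
proof (induction "degree p" arbitrary: p)
  case 0
  then show ?case
    by (metis degree_eq_zeroE proots_const image_mset_empty prod_mset_empty lead_coeff_pCons(2)
        smult_one)
next
  case (Suc n)
  then have "p \<noteq> 0"
    by auto
  have "\<not> constant (cpoly p)"
    using Suc.hyps(2) by (simp add: constant_degree degree_map_poly)
  then obtain z where z: "cpoly p z = 0"
    using fundamental_theorem_of_algebra by blast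
  then obtain x where "z = of_real x"
    using Suc.prems \<open>p \<noteq> 0\<close> unfolding real_rooted_def by (auto elim: Reals_cases)
  then have "poly p x = 0"
    using z by (simp add: cpoly_of_real)
  then obtain r where r: "p = [:-x, 1:] * r"
    by (auto simp: poly_eq_0_iff_dvd elim: dvdE)
  then have "r \<noteq> 0"
    using \<open>p \<noteq> 0\<close> by auto
  have "real_rooted r"
    using Suc.prems \<open>p \<noteq> 0\<close> unfolding real_rooted_def r cpoly_mult by auto
  moreover have "degree p = Suc (degree r)"
    using \<open>r \<noteq> 0\<close> unfolding r by (subst degree_mult_eq) auto
  ultimately have *: "r = smult (lead_coeff r) (\<Prod>x\<in>#proots r. [:-x, 1:])"
    using Suc.hyps by auto
  have "proots p = {#x#} + proots r"
    using \<open>r \<noteq> 0\<close> unfolding r by (subst proots_mult) auto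
  moreover have "lead_coeff p = lead_coeff r"
    unfolding r by (simp only: lead_coeff_mult) simp
  ultimately have "smult (lead_coeff p) (\<Prod>x\<in>#proots p. [:-x, 1:]) =
      [:-x, 1:] * smult (lead_coeff r) (\<Prod>x\<in>#proots r. [:-x, 1:])"
    by (simp only: image_mset_union image_mset_single prod_mset_Un prod_mset_singleton
        mult_smult_right)
  then show ?case
    using * r by metis
qed

lemma mset_real_zeros: "mset (real_zeros p) = proots p"
  by (simp add: real_zeros_def)

lemma real_rooted_decompose_list:
  assumes "real_rooted p"
  shows "p = smult (lead_coeff p) (\<Prod>x\<leftarrow>real_zeros p. [:-x, 1:])"
proof -
  have "(\<Prod>x\<in>#proots p. [:-x, 1:]) = (\<Prod>x\<leftarrow>real_zeros p. [:-x, 1:])"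
    by (simp flip: mset_real_zeros prod_mset_prod_list)
  then show ?thesis
    using real_rooted_decompose[OF assms] by simp
qed

section \<open>Linear factors in polar form\<close>

lemma cpoly_prod_list: "cpoly (\<Prod>x\<leftarrow>xs. [:-x, 1:]) z = (\<Prod>x\<leftarrow>xs. z - of_real x)"
  by (induction xs) (simp_all add: cpoly_mult cpoly_pCons del: mult_pCons_left)

text \<open>The sum of arguments is kept as a real number, not reduced modulo 2 \<pi>, so that
  estimates of such sums can later decide the sign of a sine.\<close>

lemma prod_list_eq_rcis:
  assumes "Im z > 0"
  shows "(\<Prod>x\<leftarrow>xs. z - of_real x) =
         of_real (\<Prod>x\<leftarrow>xs. norm (z - of_real x)) * cis (\<Sum>x\<leftarrow>xs. Arg (z - of_real x))"
proof (induction xs)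
  case (Cons x xs)
  have "z - of_real x = of_real (norm (z - of_real x)) * cis (Arg (z - of_real x))"
    by (metis rcis_cmod_Arg rcis_def)
  then show ?case
    using Cons by (simp add: cis_mult[symmetric] mult_ac)
qed simp

text \<open>The product \<open>cpoly q z * cnj (cpoly p z)\<close> is the quotient of the two values
  times the positive number \<open>norm (cpoly p z) ^ 2\<close>, so the sign of its imaginary part
  can be studied without division. The witness \<open>r\<close> is the product of the distances from
  \<open>z\<close> to all zeros of \<open>p\<close> and \<open>q\<close>.\<close>

lemma Im_real_rooted_quotient:
  assumes "real_rooted p" "real_rooted q" "p \<noteq> 0" "q \<noteq> 0" "Im z > 0"
  obtains r where "r > 0"
    "Im (cpoly q z * cnj (cpoly p z)) =
       lead_coeff p * lead_coeff q * r *
       sin ((\<Sum>x\<leftarrow>real_zeros q. Arg (z - of_real x)) - (\<Sum>x\<leftarrow>real_zeros p. Arg (z - of_real x)))"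
proof -
  have pos: "(\<Prod>x\<leftarrow>xs. norm (z - of_real x)) > 0" for xs
  proof (induction xs)
    case (Cons x xs)
    have "z - of_real x \<noteq> 0" using assms(5) by (auto simp: complex_eq_iff)
    then show ?case using Cons by simp
  qed simp
  define A B a b where "A = (\<Prod>x\<leftarrow>real_zeros p. norm (z - of_real x))"
    and "B = (\<Prod>x\<leftarrow>real_zeros q. norm (z - of_real x))"
    and "a = (\<Sum>x\<leftarrow>real_zeros p. Arg (z - of_real x))"
    and "b = (\<Sum>x\<leftarrow>real_zeros q. Arg (z - of_real x))"
  have P: "cpoly p z = of_real (lead_coeff p) * (of_real A * cis a)"
    using assms(5) unfolding A_def a_def
    by (subst real_rooted_decompose_list[OF assms(1)])
      (simp only: cpoly_smult cpoly_prod_list prod_list_eq_rcis)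
  have Q: "cpoly q z = of_real (lead_coeff q) * (of_real B * cis b)"
    using assms(5) unfolding B_def b_def
    by (subst real_rooted_decompose_list[OF assms(2)])
      (simp only: cpoly_smult cpoly_prod_list prod_list_eq_rcis)
  have "cpoly q z * cnj (cpoly p z) =
      of_real (lead_coeff p * lead_coeff q * (A * B)) * (cis b * cis (- a))"
    unfolding P Q by (simp add: cis_cnj mult_ac)
  also have "\<dots> = of_real (lead_coeff p * lead_coeff q * (A * B)) * cis (b - a)"
    by (simp add: cis_mult)
  finally have "Im (cpoly q z * cnj (cpoly p z)) =
      lead_coeff p * lead_coeff q * (A * B) * sin (b - a)"
    by simp
  moreover have "A * B > 0"
    using pos by (simp add: A_def B_def)
  ultimately show ?thesis
    using that unfolding a_def b_def by blast
qed

text \<open>\<open>Im (v * cnj u) = Im z * (y - x)\<close> is positive, hence so is the sine of the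
  difference of the arguments; both lie in \<open>(0, \<pi>)\<close>, which fixes the sign of the
  difference.\<close>

lemma Arg_diff_less:
  assumes "Im z > 0" "x < (y::real)"
  shows "Arg (z - of_real x) < Arg (z - of_real y)"
proof -
  define u v where "u = z - of_real x" and "v = z - of_real y"
  have eq: "w = of_real (norm w) * cis (Arg w)" for w
    by (metis rcis_cmod_Arg rcis_def)
  have "v * cnj u = of_real (norm v * norm u) * (cis (Arg v) * cis (- Arg u))"
    by (subst (1) eq[of v], subst (1) eq[of u]) (simp add: cis_cnj mult_ac)
  then have "v * cnj u = of_real (norm v * norm u) * cis (Arg v - Arg u)"
    by (simp add: cis_mult)
  then have "Im (v * cnj u) = norm v * norm u * sin (Arg v - Arg u)"
    by simp
  moreover have "Im (v * cnj u) = Im z * (y - x)"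
    by (simp add: u_def v_def algebra_simps)
  ultimately have "norm v * norm u * sin (Arg v - Arg u) > 0"
    using assms by simp
  then have *: "sin (Arg v - Arg u) > 0"
    by (metis mult_eq_0_iff mult_nonneg_nonpos norm_ge_zero not_le zero_le_mult_iff)
  have "0 < Arg u" "Arg u < pi" "0 < Arg v" "Arg v < pi"
    using Arg_lt_pi[of u] Arg_lt_pi[of v] assms by (auto simp: u_def v_def)
  then have "\<not> Arg v \<le> Arg u"
    using * sin_ge_zero[of "Arg u - Arg v"] by (auto simp: sin_diff mult.commute)
  then show ?thesis
    by (simp add: u_def v_def)
qed


section \<open>Interlacing polynomials\<close>

text \<open>\<open>interlace\<close> is symmetric; this relation also records that the chain of
  inequalities starts with \<open>a\<close>. It ends with \<open>b\<close> if the lengths agree and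
  with \<open>a\<close> otherwise.\<close>

definition alternate :: "'a::linorder list \<Rightarrow> 'a list \<Rightarrow> bool" where
  "alternate a b \<longleftrightarrow> length b \<le> length a \<and> length a \<le> Suc (length b) \<and>
     (\<forall>i<length b. a ! i \<le> b ! i \<and> (Suc i < length a \<longrightarrow> b ! i \<le> a ! Suc i))"

section \<open>From matched zeros to alternating lists\<close>

lemma length_real_zeros_le:
  assumes "zero_between p q"
  shows "length (real_zeros q) \<le> Suc (length (real_zeros p))"
proof -
  obtain j where j: "inj_on j {i. Suc i < length (real_zeros q)}"
    "\<forall>i\<in>{i. Suc i < length (real_zeros q)}. j i < length (real_zeros p)"
    using assms unfolding zero_between_def Let_def by blast
  have "card (j ` {i. Suc i < length (real_zeros q)}) \<le> card {..<length (real_zeros p)}"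
    by (rule card_mono) (use j in auto)
  moreover have "{i. Suc i < length (real_zeros q)} = {..<length (real_zeros q) - 1}"
    by auto
  ultimately show ?thesis
    using j by (simp add: card_image)
qed

text \<open>The matching in \<open>zero_between\<close> need not respect the order of indices.
  Counting avoids this: the \<open>k - i\<close> gaps from entry \<open>i\<close> to entry
  \<open>k\<close> are matched with distinct zeros of \<open>p\<close> in that range.\<close>

lemma zero_between_card:
  assumes "zero_between p q" "k < length (real_zeros q)"
  shows "k - i \<le> card {l. l < length (real_zeros p) \<and>
           real_zeros q ! i \<le> real_zeros p ! l \<and> real_zeros p ! l \<le> real_zeros q ! k}"
proof -
  define a b where "a = real_zeros p" and "b = real_zeros q"
  have sorted: "sorted b"
    by (simp add: b_def real_zeros_def)
  obtain j where j: "inj_on j {i. Suc i < length b}"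
    "\<And>i. Suc i < length b \<Longrightarrow> j i < length a \<and> b ! i \<le> a ! j i \<and> a ! j i \<le> b ! Suc i"
    using assms unfolding zero_between_def Let_def a_def b_def by blast
  have "j ` {i..<k} \<subseteq> {l. l < length a \<and> b ! i \<le> a ! l \<and> a ! l \<le> b ! k}"
  proof safe
    fix l assume l: "l \<in> {i..<k}"
    then have "Suc l < length b" using assms by (auto simp: b_def)
    note * = j(2)[OF this]
    show "j l < length a" using * by simp
    have "b ! i \<le> b ! l" "b ! Suc l \<le> b ! k"
      using l assms by (auto simp: b_def intro!: sorted_nth_mono[OF sorted[unfolded b_def]])
    then show "b ! i \<le> a ! j l" "a ! j l \<le> b ! k"
      using * by auto
  qed
  then have "card (j ` {i..<k}) \<le> card {l. l < length a \<and> b ! i \<le> a ! l \<and> a ! l \<le> b ! k}"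
    by (intro card_mono) auto
  moreover have "inj_on j {i..<k}"
    by (rule inj_on_subset[OF j(1)]) (use assms in \<open>auto simp: b_def\<close>)
  ultimately show ?thesis
    by (simp add: card_image a_def b_def)
qed

text \<open>Otherwise only the first \<open>i\<close> zeros of \<open>p\<close> could lie in the
  \<open>Suc i\<close> gaps below \<open>real_zeros q ! Suc i\<close>.\<close>

lemma zero_between_upper:
  assumes "zero_between p q" "Suc i < length (real_zeros q)" "i < length (real_zeros p)"
  shows "real_zeros p ! i \<le> real_zeros q ! Suc i"
proof (rule ccontr)
  assume "\<not> ?thesis"
  then have "real_zeros q ! Suc i < real_zeros p ! l" if "i \<le> l" "l < length (real_zeros p)" for l
    using that sorted_nth_mono[of "real_zeros p" i l] by (force simp: real_zeros_def)
  then have "{l. l < length (real_zeros p) \<and> real_zeros q ! 0 \<le> real_zeros p ! l \<and>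
      real_zeros p ! l \<le> real_zeros q ! Suc i} \<subseteq> {..<i}"
    by (force simp: not_le[symmetric])
  from card_mono[OF _ this] show False
    using zero_between_card[OF assms(1,2), of 0] by simp
qed

text \<open>Mirror image of \<open>zero_between_upper\<close>: otherwise only the zeros of
  \<open>p\<close> with index above \<open>i\<close> remain, one fewer than the gaps from
  \<open>real_zeros q ! i\<close> to the last zero of \<open>q\<close>.\<close>

lemma zero_between_lower:
  assumes "zero_between p q" "length (real_zeros q) = Suc (length (real_zeros p))"
    "i < length (real_zeros p)"
  shows "real_zeros q ! i \<le> real_zeros p ! i"
proof (rule ccontr)
  let ?m = "length (real_zeros p)"
  assume "\<not> ?thesis"
  then have "real_zeros p ! l < real_zeros q ! i" if "l \<le> i" for l
    using that assms sorted_nth_mono[of "real_zeros p" l i] by (force simp: real_zeros_def)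
  then have "{l. l < ?m \<and> real_zeros q ! i \<le> real_zeros p ! l \<and>
      real_zeros p ! l \<le> real_zeros q ! ?m} \<subseteq> {i<..<?m}"
    by (force simp: not_le[symmetric])
  from card_mono[OF _ this] show False
    using zero_between_card[OF assms(1), of ?m i] assms by simp
qed

text \<open>The \<open>k - i\<close> gaps of \<open>q\<close> between the two indices would have to
  share the \<open>k - i - 1\<close> zeros of \<open>p\<close> with index strictly in between. The
  opposite crossing is covered by exchanging \<open>p\<close> and \<open>q\<close>.\<close>

lemma no_crossing:
  assumes "zero_between p q" "length (real_zeros p) = length (real_zeros q)"
    "i < k" "k < length (real_zeros q)"
    "real_zeros p ! i < real_zeros q ! i" "real_zeros q ! k < real_zeros p ! k"
  shows False
proof -
  have "real_zeros p ! l < real_zeros q ! i" if "l \<le> i" for l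
    using that assms sorted_nth_mono[of "real_zeros p" l i] by (force simp: real_zeros_def)
  moreover have "real_zeros q ! k < real_zeros p ! l" if "k \<le> l" "l < length (real_zeros p)" for l
    using that assms sorted_nth_mono[of "real_zeros p" k l] by (force simp: real_zeros_def)
  ultimately have "{l. l < length (real_zeros p) \<and> real_zeros q ! i \<le> real_zeros p ! l \<and>
      real_zeros p ! l \<le> real_zeros q ! k} \<subseteq> {i<..<k}"
    by (force simp: not_le[symmetric])
  from card_mono[OF _ this] show False
    using zero_between_card[OF assms(1,4), of i] assms(3) by simp
qed

text \<open>The longer list begins. For equal lengths \<open>no_crossing\<close> puts one list
  entrywise below the other, and that one begins.\<close>

lemma interlace_imp_alternate:
  assumes "interlace p q"
  shows "alternate (real_zeros p) (real_zeros q) \<or> alternate (real_zeros q) (real_zeros p)"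
proof -
  let ?a = "real_zeros p" and ?b = "real_zeros q"
  have z: "zero_between p q" "zero_between q p"
    using assms by (auto simp: interlace_def)
  consider "length ?b = Suc (length ?a)" | "length ?a = Suc (length ?b)" | "length ?a = length ?b"
    using length_real_zeros_le[OF z(1)] length_real_zeros_le[OF z(2)] by linarith
  then show ?thesis
  proof cases
    case 1
    then have "alternate ?b ?a"
      using zero_between_upper[OF z(1)] zero_between_lower[OF z(1)] by (auto simp: alternate_def)
    then show ?thesis ..
  next
    case 2
    then have "alternate ?a ?b"
      using zero_between_upper[OF z(2)] zero_between_lower[OF z(2)] by (auto simp: alternate_def)
    then show ?thesis ..
  next
    case 3
    have "(\<forall>i<length ?b. ?a ! i \<le> ?b ! i) \<or> (\<forall>i<length ?b. ?b ! i \<le> ?a ! i)"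
    proof (rule ccontr)
      assume "\<not> ?thesis"
      then obtain i k where ik: "i < length ?b" "k < length ?b" "?a ! i < ?b ! i" "?b ! k < ?a ! k"
        by (auto simp: not_le)
      then have "i \<noteq> k" by auto
      then show False
        using no_crossing[OF z(1) 3] no_crossing[OF z(2) 3[symmetric]] ik 3
        by (metis linorder_neqE_nat)
    qed
    then show ?thesis
      using zero_between_upper[OF z(1)] zero_between_upper[OF z(2)] 3 by (auto simp: alternate_def)
  qed
qed

section \<open>Sums over alternating lists\<close>

text \<open>Regrouped, the difference of the sums is \<open>last u - hd t\<close> minus the
  nonnegative gaps \<open>t ! Suc i - u ! i\<close>. For lists of arguments this confines the
  difference to \<open>[0, \<pi>)\<close>.\<close>

lemma alternate_sum_bounds:
  fixes t u :: "real list"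
  assumes "alternate t u" "length t = length u" "t \<noteq> []"
  shows "sum_list u - sum_list t \<le> last u - hd t" "0 \<le> sum_list u - sum_list t"
    "sum_list u - sum_list t = 0 \<Longrightarrow> t = u"
proof -
  have eq: "sum_list u - sum_list t = (\<Sum>i<length u. u ! i - t ! i)"
    using assms by (simp add: sum_list_sum_nth sum_subtractf atLeast0LessThan)
  show "0 \<le> sum_list u - sum_list t"
    unfolding eq using assms by (intro sum_nonneg) (auto simp: alternate_def)
  show "t = u" if "sum_list u - sum_list t = 0"
  proof (rule nth_equalityI)
    have "(\<Sum>i<length u. u ! i - t ! i) = 0"
      using that eq by simp
    then have "\<forall>i\<in>{..<length u}. u ! i - t ! i = 0"
      using assms by (subst (asm) sum_nonneg_eq_0_iff) (auto simp: alternate_def)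
    then show "t ! i = u ! i" if "i < length t" for i
      using that assms by auto
  qed (use assms in simp)
  have "(\<Sum>i<Suc n. u ! i - t ! i) \<le> u ! n - t ! 0" if "n < length u" for n
    using that
  proof (induction n)
    case (Suc n)
    moreover have "u ! n \<le> t ! Suc n"
      using Suc.prems assms by (auto simp: alternate_def)
    ultimately show ?case by simp
  qed simp
  from this[of "length u - 1"] show "sum_list u - sum_list t \<le> last u - hd t"
    unfolding eq using assms by (cases u) (auto simp: last_conv_nth hd_conv_nth)
qed

text \<open>Pairing \<open>u ! i\<close> with \<open>t ! Suc i\<close> leaves \<open>- hd t\<close>;
  pairing it with \<open>t ! i\<close> leaves \<open>- last t\<close>.\<close>

lemma alternate_sum_bounds_Suc:
  fixes t u :: "real list"
  assumes "alternate t u" "length t = Suc (length u)"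
  shows "sum_list u - sum_list t \<le> - hd t" "- last t \<le> sum_list u - sum_list t"
proof -
  have t: "sum_list t = (\<Sum>i<Suc (length u). t ! i)"
    using assms by (simp add: sum_list_sum_nth atLeast0LessThan)
  have u: "sum_list u = (\<Sum>i<length u. u ! i)"
    by (simp add: sum_list_sum_nth atLeast0LessThan)
  have "(\<Sum>i<length u. u ! i) \<le> (\<Sum>i<length u. t ! Suc i)"
    using assms by (intro sum_mono) (auto simp: alternate_def)
  moreover have "hd t = t ! 0" "last t = t ! length u"
    using assms by (auto simp: hd_conv_nth last_conv_nth simp flip: length_0_conv)
  moreover have "(\<Sum>i<length u. t ! i) \<le> (\<Sum>i<length u. u ! i)"
    using assms by (intro sum_mono) (auto simp: alternate_def)
  ultimately show "sum_list u - sum_list t \<le> - hd t" "- last t \<le> sum_list u - sum_list t"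
    using sum.lessThan_Suc_shift[of "(!) t" "length u"] unfolding t u by auto
qed

lemma alternate_map:
  assumes "alternate a b" "mono f"
  shows "alternate (map f a) (map f b)"
  using assms by (auto simp: alternate_def mono_def)

text \<open>For \<open>z\<close> in the upper half-plane \<open>Arg (z - of_real x)\<close>
  increases strictly with \<open>x\<close> within \<open>(0, \<pi>)\<close>, so the arguments
  alternate as the zeros do. If the lists of zeros differ, their lengths alone decide the sign of
  \<open>sin (D z)\<close>.\<close>

lemma alternate_Im_constant_sign:
  assumes "real_rooted p" "real_rooted q" "p \<noteq> 0" "q \<noteq> 0"
    and alt: "alternate (real_zeros p) (real_zeros q)"
  shows "(\<exists>c. q = smult c p) \<or>
    (\<forall>z. Im z > 0 \<longrightarrow> Im (cpoly q z * cnj (cpoly p z)) > 0) \<or>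
    (\<forall>z. Im z > 0 \<longrightarrow> Im (cpoly q z * cnj (cpoly p z)) < 0)"
proof -
  define a b where "a = real_zeros p" and "b = real_zeros q"
  define \<theta> where "\<theta> z x = Arg (z - of_real x)" for z and x :: real
  define D where "D z = sum_list (map (\<theta> z) b) - sum_list (map (\<theta> z) a)" for z
  have \<theta>: "mono (\<theta> z)" "inj (\<theta> z)" "0 < \<theta> z x" "\<theta> z x < pi" if "Im z > 0" for z x
  proof -
    have "strict_mono (\<theta> z)"
      using Arg_diff_less[OF that] by (simp add: strict_mono_def \<theta>_def)
    then show "mono (\<theta> z)" "inj (\<theta> z)"
      by (simp_all add: strict_mono_mono strict_mono_imp_inj_on)
    show "0 < \<theta> z x" "\<theta> z x < pi"
      using Arg_lt_pi[of "z - of_real x"] that by (auto simp: \<theta>_def)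
  qed
  note alt' = alternate_map[OF alt[folded a_def b_def] \<theta>(1)]
  \<comment> \<open>The leading coefficients stay a separate factor because their sign does not
    depend on \<open>z\<close>.\<close>
  have K: "\<exists>r>0. Im (cpoly q z * cnj (cpoly p z)) = (lead_coeff p * lead_coeff q) * (r * sin (D z))"
    if z: "Im z > 0" for z
  proof -
    obtain r where "r > 0"
      "Im (cpoly q z * cnj (cpoly p z)) = lead_coeff p * lead_coeff q * r * sin (D z)"
      using Im_real_rooted_quotient[OF assms(1-4) z]
      unfolding D_def \<theta>_def a_def b_def by blast
    then show ?thesis
      by (intro exI[of _ r]) (simp only: mult.assoc simp_thms)
  qed
  have lc: "lead_coeff p * lead_coeff q \<noteq> 0"
    using assms(3,4) by simp
  consider "a = b" | "length a = length b" "a \<noteq> b" | "length a = Suc (length b)"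
    using alt unfolding alternate_def a_def b_def by linarith
  then show ?thesis
  proof cases
    case 1
    define \<pi> where "\<pi> = (\<Prod>x\<leftarrow>a. [:-x, 1:])"
    have p: "p = smult (lead_coeff p) \<pi>" and q: "q = smult (lead_coeff q) \<pi>"
      using real_rooted_decompose_list[OF assms(1)] real_rooted_decompose_list[OF assms(2)] 1
      by (simp_all only: \<pi>_def a_def b_def)
    have "smult (lead_coeff q / lead_coeff p) p =
        smult (lead_coeff q / lead_coeff p * lead_coeff p) \<pi>"
      by (subst (2) p) (rule smult_smult)
    also have "\<dots> = smult (lead_coeff q) \<pi>"
      using assms(3) by simp
    also note q[symmetric]
    finally show ?thesis by metis
  next
    case 2
    have "sin (D z) > 0" if "Im z > 0" for z
    proof (rule sin_gt_zero)
      let ?t = "map (\<theta> z) a" and ?u = "map (\<theta> z) b"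
      have *: "length ?t = length ?u" "?t \<noteq> []" "?u \<noteq> []"
        using 2 by auto
      \<comment> \<open>A zero difference would make the lists of arguments equal, and
        \<open>\<theta> z\<close> is injective.\<close>
      have "D z \<noteq> 0"
        using alternate_sum_bounds(3)[OF alt'[OF that] *(1,2)] \<theta>(2)[OF that] 2(2)
        unfolding D_def by (auto simp: inj_map_eq_map)
      then show "0 < D z"
        using alternate_sum_bounds(2)[OF alt'[OF that] *(1,2)] unfolding D_def by linarith
      have "last ?u < pi" "hd ?t > 0"
        using \<theta>[OF that] * by (auto simp: last_map hd_map)
      then show "D z < pi"
        using alternate_sum_bounds(1)[OF alt'[OF that] *(1,2)] unfolding D_def by linarith
    qed
    then have "\<exists>s>0. Im (cpoly q z * cnj (cpoly p z)) = (lead_coeff p * lead_coeff q) * s"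
      if "Im z > 0" for z
      using K[OF that] mult_pos_pos that by blast
    then show ?thesis
      using lc by (cases "lead_coeff p * lead_coeff q > 0")
        (metis mult_pos_pos, metis linorder_neqE_linordered_idom mult_neg_pos)
  next
    case 3
    have "sin (D z) < 0" if "Im z > 0" for z
    proof -
      let ?t = "map (\<theta> z) a" and ?u = "map (\<theta> z) b"
      have *: "length ?t = Suc (length ?u)" "?t \<noteq> []"
        using 3 by auto
      have "last ?t < pi" "hd ?t > 0"
        using \<theta>[OF that] * by (auto simp: last_map hd_map)
      \<comment> \<open>\<open>- D z\<close> lies between the first and the last argument belonging
        to \<open>p\<close>.\<close>
      then have "0 < - D z" "- D z < pi"
        using alternate_sum_bounds_Suc[OF alt'[OF that] *(1)] unfolding D_def by linarith+
      then have "sin (- D z) > 0"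
        by (rule sin_gt_zero)
      then show ?thesis by simp
    qed
    then have "\<exists>s<0. Im (cpoly q z * cnj (cpoly p z)) = (lead_coeff p * lead_coeff q) * s"
      if "Im z > 0" for z
      using K[OF that] mult_pos_neg that by blast
    then show ?thesis
      using lc by (cases "lead_coeff p * lead_coeff q > 0")
        (metis mult_pos_neg, metis linorder_neqE_linordered_idom mult_neg_neg)
  qed
qed

text \<open>Exchanging \<open>p\<close> and \<open>q\<close> conjugates the product and so flips the
  sign of its imaginary part; hence either orientation of the alternation will do.\<close>

lemma interlace_Im_constant_sign:
  assumes "real_rooted p" "real_rooted q" "p \<noteq> 0" "q \<noteq> 0" "interlace p q"
  shows "(\<exists>c. q = smult c p) \<or>
    (\<forall>z. Im z > 0 \<longrightarrow> Im (cpoly q z * cnj (cpoly p z)) > 0) \<or>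
    (\<forall>z. Im z > 0 \<longrightarrow> Im (cpoly q z * cnj (cpoly p z)) < 0)"
  using interlace_imp_alternate[OF assms(5)]
proof
  assume "alternate (real_zeros p) (real_zeros q)"
  then show ?thesis
    using alternate_Im_constant_sign assms by blast
next
  assume "alternate (real_zeros q) (real_zeros p)"
  then have "(\<exists>c. p = smult c q) \<or>
    (\<forall>z. Im z > 0 \<longrightarrow> Im (cpoly p z * cnj (cpoly q z)) > 0) \<or>
    (\<forall>z. Im z > 0 \<longrightarrow> Im (cpoly p z * cnj (cpoly q z)) < 0)"
    using alternate_Im_constant_sign assms by blast
  moreover have "Im (cpoly p z * cnj (cpoly q z)) = - Im (cpoly q z * cnj (cpoly p z))" for z
    by (simp add: algebra_simps)
  moreover have "q = smult (1 / c) p" if "p = smult c q" for c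
    using that assms(3) by auto
  ultimately show ?thesis
    by (metis neg_0_less_iff_less neg_less_0_iff_less)
qed

section \<open>The Wronskian\<close>

text \<open>On the vertical line through \<open>x\<close> the imaginary part \<open>g\<close>
  vanishes at height 0 and has derivative \<open>- ?W\<close> there. A negative \<open>?W\<close>
  would make \<open>g\<close> positive just above the real axis.\<close>

lemma Im_neg_imp_wronskian_nonneg:
  assumes "\<And>z. Im z > 0 \<Longrightarrow> Im (cpoly q z * cnj (cpoly p z)) < 0"
  shows "poly (pderiv p * q - p * pderiv q) x \<ge> 0"
proof (rule ccontr)
  let ?W = "poly (pderiv p * q - p * pderiv q) x"
  define g where "g y = Im (cpoly q (Complex x y) * cnj (cpoly p (Complex x y)))" for y
  have line: "((\<lambda>y. cpoly r (Complex x y)) has_vector_derivative \<i> * of_real (poly (pderiv r) x)) (at 0)" for r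
  proof -
    have "((\<lambda>y. Complex x y) has_vector_derivative \<i>) (at 0)"
      unfolding Complex_eq by (auto intro!: derivative_eq_intros simp: has_vector_derivative_def scaleR_conv_of_real mult.commute)
    moreover have "(cpoly r has_field_derivative of_real (poly (pderiv r) x)) (at (Complex x 0))"
    proof -
      have "pderiv (map_poly complex_of_real r) = map_poly of_real (pderiv r)"
        by (rule poly_eqI) (simp add: coeff_pderiv coeff_map_poly)
      then show ?thesis
        using poly_DERIV[of "map_poly of_real r" "Complex x 0"] cpoly_of_real[of "pderiv r" x]
        by (simp add: complex_of_real_def)
    qed
    ultimately show ?thesis
      using field_vector_diff_chain_at[of "Complex x" \<i> 0 "cpoly r"] by (simp add: o_def)
  qed
  have "((\<lambda>y. cpoly q (Complex x y) * cnj (cpoly p (Complex x y))) has_vector_derivative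
      cpoly q (Complex x 0) * cnj (\<i> * of_real (poly (pderiv p) x)) +
      \<i> * of_real (poly (pderiv q) x) * cnj (cpoly p (Complex x 0))) (at 0)"
    by (intro has_vector_derivative_mult line has_vector_derivative_cnj)
  moreover have "cpoly r (Complex x 0) = of_real (poly r x)" for r
    using cpoly_of_real[of r x] by (simp add: complex_of_real_def)
  ultimately have "(g has_vector_derivative - ?W) (at 0)"
    unfolding g_def using bounded_linear.has_vector_derivative[OF bounded_linear_Im]
    by (fastforce simp: algebra_simps)
  then have "DERIV g 0 :> - ?W"
    by (simp add: has_real_derivative_iff_has_vector_derivative)
  moreover assume "\<not> 0 \<le> ?W"
  ultimately obtain d where "d > 0" "\<And>h. 0 < h \<Longrightarrow> h < d \<Longrightarrow> g 0 < g (0 + h)"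
    using DERIV_pos_inc_right[of g "- ?W" 0] by auto
  then have "g 0 < g (d / 2)" "d / 2 > 0"
    by auto
  moreover have "g 0 = 0"
    using \<open>\<And>r. cpoly r (Complex x 0) = of_real (poly r x)\<close> by (simp add: g_def)
  ultimately show False
    using assms[of "Complex x (d / 2)"] by (simp add: g_def)
qed

text \<open>Compare leading coefficients of the two products: differentiation multiplies the leading
  coefficient by the degree.\<close>

lemma wronskian_eq_0_imp_degree_eq:
  fixes p q :: "real poly"
  assumes "pderiv p * q = p * pderiv q" "p \<noteq> 0" "q \<noteq> 0"
  shows "degree p = degree q"
proof (cases "degree p = 0 \<or> degree q = 0")
  case True
  then have "pderiv p = 0 \<or> pderiv q = 0"
    by (auto simp: pderiv_eq_0_iff)
  then have "pderiv p = 0 \<and> pderiv q = 0"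
    using assms by (metis mult_eq_0_iff)
  then show ?thesis
    by (simp add: pderiv_eq_0_iff)
next
  case False
  then have nz: "pderiv p \<noteq> 0" "pderiv q \<noteq> 0"
    by (auto simp: pderiv_eq_0_iff)
  have "lead_coeff (pderiv r) = of_nat (degree r) * lead_coeff r" if "degree r \<noteq> 0" for r :: "real poly"
    using that by (simp add: degree_pderiv coeff_pderiv)
  moreover have "lead_coeff (pderiv p) * lead_coeff q = lead_coeff p * lead_coeff (pderiv q)"
    using assms(1) by (metis lead_coeff_mult)
  ultimately have "of_nat (degree p) * lead_coeff p * lead_coeff q =
      lead_coeff p * (of_nat (degree q) * lead_coeff q)"
    using False by metis
  then show ?thesis
    using assms(2,3) by simp
qed

text \<open>Subtracting from \<open>q\<close> the multiple of \<open>p\<close> with the same leading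
  coefficient keeps the Wronskian zero. A nonzero remainder \<open>u\<close> would have the degree
  of \<open>p\<close>, but its coefficient there cancels.\<close>

lemma wronskian_eq_0_imp_proportional:
  fixes p q :: "real poly"
  assumes "pderiv p * q = p * pderiv q" "p \<noteq> 0"
  shows "\<exists>c. q = smult c p"
proof (rule ccontr)
  assume neg: "\<not> ?thesis"
  then have "q \<noteq> 0"
    by (metis smult_0_left)
  then have deg: "degree p = degree q"
    using wronskian_eq_0_imp_degree_eq assms by blast
  define c where "c = lead_coeff q / lead_coeff p"
  define u where "u = q - smult c p"
  have "u \<noteq> 0"
    using neg unfolding u_def by (metis eq_iff_diff_eq_0)
  have "pderiv p * u = p * pderiv u"
    using assms(1) by (simp add: u_def pderiv_diff pderiv_smult algebra_simps)
  then have "degree u = degree p"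
    using wronskian_eq_0_imp_degree_eq assms(2) \<open>u \<noteq> 0\<close> by metis
  then have "lead_coeff u = 0"
    using deg leading_coeff_0_iff[of p] assms(2) by (simp add: u_def c_def)
  then show False
    using \<open>u \<noteq> 0\<close> by simp
qed

text \<open>The other constant sign would make the Wronskian nonnegative, while
  \<open>\<prec>\<prec>\<close> makes it nonpositive. It would vanish, and \<open>q\<close> would be
  a multiple of \<open>p\<close>.\<close>

lemma interlaces_Im_pos:
  assumes "p \<prec>\<prec> q" "p \<noteq> 0" "q \<noteq> 0" "\<nexists>c. q = smult c p" "Im z > 0"
  shows "Im (cpoly q z * cnj (cpoly p z)) > 0"
proof -
  have "\<not> (\<forall>z. Im z > 0 \<longrightarrow> Im (cpoly q z * cnj (cpoly p z)) < 0)"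
  proof
    assume "\<forall>z. Im z > 0 \<longrightarrow> Im (cpoly q z * cnj (cpoly p z)) < 0"
    then have "poly (pderiv p * q - p * pderiv q) x \<ge> 0" for x
      using Im_neg_imp_wronskian_nonneg by blast
    moreover have "poly (pderiv p * q - p * pderiv q) x \<le> 0" for x
      using assms(1-3) unfolding interlaces_def by blast
    ultimately have "poly (pderiv p * q - p * pderiv q) x = 0" for x
      by (metis order_antisym)
    then have "pderiv p * q - p * pderiv q = 0"
      by (metis poly_all_0_iff_0)
    then show False
      using wronskian_eq_0_imp_proportional assms(2,4) by auto
  qed
  then show ?thesis
    using interlace_Im_constant_sign[of p q] assms unfolding interlaces_def by blast
qed

section \<open>Sums of interlacing polynomials\<close>

text \<open>Nonreal zeros of a real polynomial come in conjugate pairs.\<close>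

lemma real_rootedI:
  assumes "\<And>z. Im z > 0 \<Longrightarrow> cpoly p z \<noteq> 0"
  shows "real_rooted p"
proof -
  have "z \<in> \<real>" if "cpoly p z = 0" for z
  proof (rule ccontr)
    assume "z \<notin> \<real>"
    then have "Im z > 0 \<or> Im (cnj z) > 0"
      by (auto simp: complex_is_Real_iff)
    moreover have "cpoly p (cnj z) = 0"
      using that by (simp add: cpoly_cnj)
    ultimately show False
      using assms that by blast
  qed
  then show ?thesis
    by (auto simp: real_rooted_def)
qed

lemma real_rooted_smult: "real_rooted p \<Longrightarrow> real_rooted (smult c p)"
  by (auto simp: real_rooted_def cpoly_smult)

text \<open>After multiplication by \<open>cnj (cpoly p z)\<close>, multiples of \<open>p\<close>
  have imaginary part 0 and all other summands a positive one, so a single nonproportional summand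
  keeps the sum away from 0.\<close>

lemma real_rooted_sum:
  assumes "finite A" "p \<noteq> 0" "real_rooted p" "\<And>i. i \<in> A \<Longrightarrow> p \<prec>\<prec> q i"
  shows "real_rooted (\<Sum>i\<in>A. q i)"
proof (cases "\<forall>i\<in>A. \<exists>c. q i = smult c p")
  case True
  then obtain c where "\<And>i. i \<in> A \<Longrightarrow> q i = smult (c i) p"
    by metis
  then have "(\<Sum>i\<in>A. q i) = smult (\<Sum>i\<in>A. c i) p"
    by (simp add: smult_sum)
  then show ?thesis
    using assms(3) real_rooted_smult by simp
next
  case False
  then obtain k where k: "k \<in> A" "\<nexists>c. q k = smult c p"
    by blast
  show ?thesis
  proof (rule real_rootedI)
    fix z assume z: "Im z > 0"
    \<comment> \<open>Here \<open>q i\<close> is nonzero, since 0 is the multiple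
      \<open>smult 0 p\<close>.\<close>
    have pos: "Im (cpoly (q i) z * cnj (cpoly p z)) > 0" if "i \<in> A" "\<nexists>c. q i = smult c p" for i
      using interlaces_Im_pos[OF assms(4)[OF that(1)] assms(2) _ that(2) z] that(2)
      by (metis smult_0_left)
    have "Im (cpoly (q i) z * cnj (cpoly p z)) \<ge> 0" if "i \<in> A" for i
    proof (cases "\<exists>c. q i = smult c p")
      case True
      then show ?thesis by (auto simp: cpoly_smult)
    qed (use pos[OF that] in simp)
    then have "(\<Sum>i\<in>A. Im (cpoly (q i) z * cnj (cpoly p z))) > 0"
      using pos[OF k] k(1) assms(1) by (intro sum_pos2[of A k]) auto
    then have "Im (cpoly (\<Sum>i\<in>A. q i) z * cnj (cpoly p z)) > 0"
      by (simp only: cpoly_sum sum_distrib_right Im_sum)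
    then show "cpoly (\<Sum>i\<in>A. q i) z \<noteq> 0"
      by auto
  qed
qed

lemma real_rooted_sum_list:
  assumes "interlacing_sequence ps"
  shows "real_rooted (sum_list ps)"
proof (cases "\<exists>i. i < length ps \<and> ps ! i \<noteq> 0")
  case True
  define k where "k = (LEAST i. i < length ps \<and> ps ! i \<noteq> 0)"
  have k: "k < length ps" "ps ! k \<noteq> 0"
    using LeastI_ex[OF True] by (auto simp: k_def)
  have rr: "real_rooted (ps ! i)" if "i < length ps" for i
    using assms that by (simp add: interlacing_sequence_def)
  have "ps ! k \<prec>\<prec> ps ! i" if "i < length ps" for i
  proof (cases "k \<le> i")
    case True
    then show ?thesis
      using assms that by (simp add: interlacing_sequence_def)
  next
    case False
    \<comment> \<open>Entries before the first nonzero one vanish, and the convention that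
      \<open>p \<prec>\<prec> 0\<close> for real-rooted \<open>p\<close> covers them.\<close>
    then have "ps ! i = 0"
      using not_less_Least[of i "\<lambda>i. i < length ps \<and> ps ! i \<noteq> 0"] that
      unfolding k_def by auto
    then show ?thesis
      using rr[OF k(1)] by (simp add: interlaces_def real_rooted_def)
  qed
  then show ?thesis
    unfolding sum_list_sum_nth using k rr by (intro real_rooted_sum[of _ "ps ! k"]) auto
next
  case False
  then have "sum_list ps = 0"
    by (simp add: sum_list_sum_nth)
  then show ?thesis
    by (simp add: real_rooted_def)
qed


section \<open>The \<open>h\<close>-polynomial of a subdivision\<close>

lemma finite_chains: "finite C \<Longrightarrow> finite {K. subset.chain (proper_faces C F) K}"
  by (rule finite_subset[of _ "Pow C"]) (auto simp: subset.chain_def proper_faces_def)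

text \<open>A longest chain of proper faces of \<open>E\<close> becomes a longer chain below
  \<open>F\<close> by adding \<open>E\<close> on top.\<close>

lemma face_dim_strict_mono:
  assumes "finite C" "E \<in> C" "E \<subset> F"
  shows "face_dim C E < face_dim C F"
proof -
  let ?ch = "\<lambda>F. {K. subset.chain (proper_faces C F) K}"
  have "{} \<in> ?ch E"
    by (simp add: subset.chain_def)
  then have "Max (card ` ?ch E) \<in> card ` ?ch E"
    using finite_chains[OF assms(1)] by (intro Max_in finite_imageI) blast+
  then obtain K where K: "K \<in> ?ch E" "card K = Max (card ` ?ch E)"
    by auto
  have "insert E K \<in> ?ch F"
    using K(1) assms by (auto simp: subset.chain_def proper_faces_def)
  then have "card (insert E K) \<le> Max (card ` ?ch F)"
    using finite_chains[OF assms(1)] by (intro Max_ge) auto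
  moreover have "E \<notin> K" "finite K"
    using K(1) assms(1) by (auto simp: subset.chain_def proper_faces_def intro: finite_subset)
  ultimately show ?thesis
    using K(2) by (simp add: face_dim_def)
qed

text \<open>Monotonicity of \<open>\<phi>\<close> closes the restriction under passing to faces, so
  \<open>G\<close> has the same proper faces in both complexes.\<close>

lemma restriction_face_dim:
  assumes "\<And>G H. G \<in> C' \<Longrightarrow> H \<in> C' \<Longrightarrow> G \<subseteq> H \<Longrightarrow> \<phi> G \<subseteq> \<phi> H" "G \<in> restriction C' \<phi> F"
  shows "face_dim (restriction C' \<phi> F) G = face_dim C' G"
proof -
  have "proper_faces (restriction C' \<phi> F) G = proper_faces C' G"
    using assms unfolding proper_faces_def restriction_def by blast
  then show ?thesis
    by (simp add: face_dim_def)
qed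

lemma ex_facet:
  assumes "finite C" "F \<in> C"
  shows "\<exists>G\<in>facets C. F \<subseteq> G"
proof -
  obtain G where "G \<in> C" "F \<subseteq> G" "\<forall>H\<in>C. G \<subseteq> H \<longrightarrow> G = H"
    using finite_has_maximal2[OF assms] by blast
  then show ?thesis
    unfolding facets_def by blast
qed

lemma rel_dim_eqI:
  assumes "finite R" "\<And>G. G \<in> R \<Longrightarrow> face_dim C G \<le> d" "G \<in> R" "face_dim C G = d"
  shows "rel_dim C R = d"
  unfolding rel_dim_def using assms by (intro Max_eqI) auto

section \<open>The pieces of a fixed subdivision\<close>

locale subdivided_complex =
  fixes C :: "'v set set" and C' :: "'w set set" and \<phi> :: "'w set \<Rightarrow> 'v set"
  assumes subdivision: "subdivision C' C \<phi>"
begin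

lemma finite_complexes: "finite C" "finite C'"
  using subdivision by (auto simp: subdivision_def polytopal_complex_def)

lemma Int_closed: "E \<in> C \<Longrightarrow> F \<in> C \<Longrightarrow> E \<inter> F \<in> C"
  using subdivision by (simp add: subdivision_def polytopal_complex_def)

lemma face_dim_restriction:
  assumes "G \<in> restriction C' \<phi> F"
  shows "face_dim (restriction C' \<phi> F) G = face_dim C' G"
proof (rule restriction_face_dim[OF _ assms])
  show "\<phi> G \<subseteq> \<phi> H" if "G \<in> C'" "H \<in> C'" "G \<subseteq> H" for G H
    using subdivision that unfolding subdivision_def by blast
qed

text \<open>\<open>ball_with_boundary\<close> gives the dimension measured inside the restriction;
  \<open>face_dim_restriction\<close> converts it to the one measured in \<open>C'\<close>.\<close>

lemma rel_dim_restriction: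
  assumes "F \<in> C"
  shows "rel_dim C' (restriction C' \<phi> F) = face_dim C F"
proof -
  have "complex_dim (restriction C' \<phi> F) = face_dim C F"
    using subdivision assms by (auto simp: subdivision_def ball_with_boundary_def)
  moreover have "face_dim (restriction C' \<phi> F) ` restriction C' \<phi> F = face_dim C' ` restriction C' \<phi> F"
    using face_dim_restriction by (intro image_cong) auto
  ultimately show ?thesis
    by (simp add: rel_dim_def)
qed

lemma finite_restriction: "finite (restriction C' \<phi> F)"
  using finite_complexes(2) by (simp add: restriction_def)

lemma face_dim_le:
  assumes "F \<in> C" "G \<in> restriction C' \<phi> F"
  shows "face_dim C' G \<le> face_dim C F"
proof -
  have "face_dim C' G \<le> rel_dim C' (restriction C' \<phi> F)"
    unfolding rel_dim_def using assms finite_restriction by (intro Max_ge) auto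
  then show ?thesis
    using rel_dim_restriction[OF assms(1)] by simp
qed


text \<open>The ball over the empty polytope has dimension -1, so it is \<open>{{}}\<close> and
  \<open>\<phi> {}\<close> is empty. This makes restrictions nonempty, so that their dimension is
  attained by a face.\<close>

lemma empty_in_restriction: "{} \<in> restriction C' \<phi> F"
proof -
  have C: "{} \<in> C"
    using subdivision by (auto simp: subdivision_def polytopal_complex_def)
  have "{K. subset.chain (proper_faces C {}) K} = {{}}"
    by (auto simp: subset.chain_def proper_faces_def)
  then have "face_dim C {} = -1"
    by (simp add: face_dim_def)
  then have "restriction C' \<phi> {} = {{}}"
    using subdivision C unfolding subdivision_def ball_with_boundary_def by (metis (no_types))
  then show ?thesis
    by (auto simp: restriction_def)
qed

lemma ex_face_dim_eq:
  assumes "F \<in> C"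
  obtains G where "G \<in> restriction C' \<phi> F" "face_dim C' G = face_dim C F"
proof -
  have "Max (face_dim C' ` restriction C' \<phi> F) \<in> face_dim C' ` restriction C' \<phi> F"
    using finite_restriction empty_in_restriction[of F] by (intro Max_in) auto
  then show ?thesis
    using that rel_dim_restriction[OF assms] unfolding rel_dim_def by auto
qed

text \<open>\<open>h_poly\<close> normalises by the dimension, so additivity needs pieces of equal
  dimension. A face \<open>G\<close> of top dimension survives the removal: over an earlier facet it
  would also lie over the intersection, a face of \<open>C\<close> of smaller dimension.\<close>

lemma rel_dim_relative_complex:
  assumes "distinct Fs" "set Fs = facets C" "i < length Fs"
  shows "rel_dim C' (relative_complex C' \<phi> Fs i) = face_dim C (Fs ! i)"
proof -
  have facet: "Fs ! k \<in> facets C" if "k < length Fs" for k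
    using nth_mem[OF that] assms(2) by simp
  then have inC: "Fs ! k \<in> C" if "k < length Fs" for k
    using that unfolding facets_def by blast
  obtain G where G: "G \<in> restriction C' \<phi> (Fs ! i)" "face_dim C' G = face_dim C (Fs ! i)"
    using ex_face_dim_eq[OF inC[OF assms(3)]] .
  have "G \<notin> restriction C' \<phi> (Fs ! k)" if "k < i" for k
  proof
    assume "G \<in> restriction C' \<phi> (Fs ! k)"
    then have *: "G \<in> restriction C' \<phi> (Fs ! i \<inter> Fs ! k)"
      using G(1) by (auto simp: restriction_def)
    have "Fs ! i \<inter> Fs ! k \<in> C"
      using Int_closed inC assms(3) that by simp
    moreover have "Fs ! i \<noteq> Fs ! k"
      using assms(1,3) that by (auto simp: nth_eq_iff_index_eq)
    \<comment> \<open>If the intersection were all of \<open>Fs ! i\<close>, that facet would lie in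
      \<open>Fs ! k\<close> and equal it by maximality.\<close>
    then have "Fs ! i \<inter> Fs ! k \<subset> Fs ! i"
      using facet[OF assms(3)] inC[of k] that assms(3) unfolding facets_def by fastforce
    ultimately show False
      using face_dim_le[OF _ *] face_dim_strict_mono[OF finite_complexes(1)] G(2) by (metis not_le)
  qed
  then have "G \<in> relative_complex C' \<phi> Fs i"
    using G(1) by (auto simp: relative_complex_def)
  moreover have "relative_complex C' \<phi> Fs i \<subseteq> restriction C' \<phi> (Fs ! i)"
    by (auto simp: relative_complex_def)
  ultimately show ?thesis
    using G(2) face_dim_le[OF inC[OF assms(3)]] finite_subset[OF _ finite_restriction]
    by (intro rel_dim_eqI) auto
qed

text \<open>A face \<open>G\<close> belongs to the piece of the first facet containing
  \<open>\<phi> G\<close>.\<close>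

lemma Union_relative_complex:
  assumes "set Fs = facets C"
  shows "(\<Union>i<length Fs. relative_complex C' \<phi> Fs i) = C'"
proof
  show "C' \<subseteq> (\<Union>i<length Fs. relative_complex C' \<phi> Fs i)"
  proof
    fix G assume G: "G \<in> C'"
    then have "\<phi> G \<in> C"
      using subdivision by (auto simp: subdivision_def)
    then obtain F where "F \<in> facets C" "\<phi> G \<subseteq> F"
      using ex_facet[OF finite_complexes(1)] by blast
    then have ex: "\<exists>i. i < length Fs \<and> G \<in> restriction C' \<phi> (Fs ! i)"
      using G assms by (metis (mono_tags, lifting) in_set_conv_nth mem_Collect_eq restriction_def)
    define i where "i = (LEAST i. i < length Fs \<and> G \<in> restriction C' \<phi> (Fs ! i))"
    have "i < length Fs \<and> G \<in> restriction C' \<phi> (Fs ! i)"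
      unfolding i_def using ex by (rule LeastI_ex)
    moreover have "G \<notin> restriction C' \<phi> (Fs ! k)" if "k < i" for k
      using not_less_Least[OF that[unfolded i_def]] that calculation by auto
    ultimately show "G \<in> (\<Union>i<length Fs. relative_complex C' \<phi> Fs i)"
      by (auto simp: relative_complex_def)
  qed
qed (auto simp: relative_complex_def restriction_def)

lemma disjoint_relative_complex:
  assumes "i \<noteq> j"
  shows "relative_complex C' \<phi> Fs i \<inter> relative_complex C' \<phi> Fs j = {}"
proof -
  have "relative_complex C' \<phi> Fs i \<inter> relative_complex C' \<phi> Fs j = {}" if "i < j" for i j
    using that unfolding relative_complex_def by blast
  then show ?thesis
    using assms by (metis Int_commute linorder_neqE_nat)
qed

lemma f_poly_sum:
  assumes "set Fs = facets C"
  shows "f_poly C' C' = (\<Sum>i<length Fs. f_poly C' (relative_complex C' \<phi> Fs i))"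
proof -
  have "f_poly C' C' = f_poly C' (\<Union>i<length Fs. relative_complex C' \<phi> Fs i)"
    by (simp add: Union_relative_complex[OF assms])
  also have "\<dots> = (\<Sum>i<length Fs. f_poly C' (relative_complex C' \<phi> Fs i))"
    unfolding f_poly_def using disjoint_relative_complex finite_restriction
    by (intro sum.UNION_disjoint) (auto simp: relative_complex_def)
  finally show ?thesis .
qed

text \<open>For a fixed exponent \<open>m\<close>, \<open>h_poly\<close> is linear in the
  coefficients of the f-polynomial. Purity gives all facets, hence all pieces and \<open>C'\<close>
  itself, the same dimension \<open>d\<close>, so \<open>m\<close> agrees throughout.\<close>

lemma h_poly_sum:
  assumes "distinct Fs" "set Fs = facets C" "pure C"
  shows "h_poly C' C' = (\<Sum>i<length Fs. h_poly C' (relative_complex C' \<phi> Fs i))"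
proof -
  have "{} \<in> C"
    using subdivision by (auto simp: subdivision_def polytopal_complex_def)
  then obtain F where F: "F \<in> facets C"
    using ex_facet[OF finite_complexes(1)] by blast
  define d where "d = face_dim C F"
  have d: "face_dim C (Fs ! i) = d" if "i < length Fs" for i
    using nth_mem[OF that] assms(2,3) F unfolding pure_def d_def by metis
  have R: "rel_dim C' (relative_complex C' \<phi> Fs i) = d" if "i < length Fs" for i
    using rel_dim_relative_complex[OF assms(1,2) that] d[OF that] by simp
  obtain G where G: "G \<in> restriction C' \<phi> F" "face_dim C' G = d"
    using ex_face_dim_eq F unfolding d_def facets_def by blast
  have "rel_dim C' C' = d"
  proof (rule rel_dim_eqI[OF finite_complexes(2) _ _ G(2)])
    show "G \<in> C'"
      using G(1) by (auto simp: restriction_def)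
    show "face_dim C' H \<le> d" if "H \<in> C'" for H
    proof -
      from that obtain i where i: "i < length Fs" "H \<in> restriction C' \<phi> (Fs ! i)"
        using Union_relative_complex[OF assms(2)] by (auto simp: relative_complex_def)
      moreover have "Fs ! i \<in> C"
        using i(1) assms(2) nth_mem unfolding facets_def by blast
      ultimately show ?thesis
        using face_dim_le d by metis
    qed
  qed
  then show ?thesis
    by (simp add: h_poly_def Let_def R f_poly_sum[OF assms(2)] coeff_sum smult_sum sum.swap[of _ "{..<_}"])
qed

end

theorem theorem3p1:
  fixes C :: "'v set set" and C' :: "'w set set" and \<phi> :: "'w set \<Rightarrow> 'v set"
    and Fs :: "'v set list"
  assumes "polytopal_complex C"
    and "shelling C Fs"
    and "subdivision C' C \<phi>"
    and "\<exists>\<sigma>. \<sigma> permutes {..<length Fs} \<and>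
           interlacing_sequence
             (map (\<lambda>i. h_poly C' (relative_complex C' \<phi> Fs (\<sigma> i))) [0..<length Fs])"
  shows "real_rooted (h_poly C' C')"
proof -
  interpret subdivided_complex C C' \<phi>
    by unfold_locales (fact assms(3))
  obtain \<sigma> where \<sigma>: "\<sigma> permutes {..<length Fs}"
    "interlacing_sequence (map (\<lambda>i. h_poly C' (relative_complex C' \<phi> Fs (\<sigma> i))) [0..<length Fs])"
    using assms(4) by blast
  have "distinct Fs" "set Fs = facets C" "pure C"
    using assms(2) by (auto elim: shelling.cases)
  then have "h_poly C' C' = (\<Sum>i<length Fs. h_poly C' (relative_complex C' \<phi> Fs i))"
    by (rule h_poly_sum)
  \<comment> \<open>The pieces are defined by the shelling order, but their sum may be taken in the
    order of \<open>\<sigma>\<close>.\<close>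
  also have "\<dots> = (\<Sum>i<length Fs. h_poly C' (relative_complex C' \<phi> Fs (\<sigma> i)))"
    using sum.permute[OF \<sigma>(1)] by (simp add: o_def)
  also have "\<dots> = sum_list (map (\<lambda>i. h_poly C' (relative_complex C' \<phi> Fs (\<sigma> i))) [0..<length Fs])"
    by (simp add: sum_list_distinct_conv_sum_set atLeast0LessThan)
  finally show ?thesis
    using real_rooted_sum_list[OF \<sigma>(2)] by simp
qed

end
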